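(* Let $V$ be a finite-dimensional vector space over a field $F$. (a) If $Q\colon V\to F$ is a quadratic form with non-degenerate polar form $B$ and induced linear mapping $D\colon V\to V^*$, then the quadratic form $$Q^\uparrow:=Q\circ D^{-1}\circ\nu^{\mathrm T}\colon F\times V^*\to F\colon (a_0,a^* )\mapsto (Q\circ D^{-1})(a^* )$$ satisfies $Q^\uparrow(1,o^* )=0$, and the polar form $B^\uparrow$ of $Q^\uparrow$ has $F(1,o^* )$ as its radical. (b) If $\tilde Q\colon F\times V^*\to F$ is a quadratic form with $\tilde Q(1,o^* )=0$ and with $F(1,o^* )$ being the radical of its polar form $\tilde B$, and $\tilde D\colon F\times V^*\to F\times V$ is the induced linear mapping of $\tilde B$, then the linear mapping $\pi\circ\tilde D\circ\pi^{\mathrm T}\colon V^*\to V$ is invertible, and the quadratic form $$\tilde Q^\downarrow:=\tilde Q\circ\pi^{\mathrm T}\circ(\pi\circ\tilde D\circ\pi^{\mathrm T})^{-1}\colon V\to F\colon x\mapsto \tilde Q\bigl(0,(\pi\circ\tilde D\circ\pi^{\mathrm T})^{-1}(x)\bigr)$$ has a non-degenerate polar form $\tilde B^\downarrow$. (c) If $Q$ is given as in (a), then $(Q^\uparrow)^\downarrow=Q$ and $cQ^\uparrow=(cQ)^\uparrow$ for all $c\in F^\times$. (d) If $\tilde Q$ is given as in (b), then $(\tilde Q^\downarrow)^\uparrow=\tilde Q$ and $c\tilde Q^\downarrow=(c\tilde Q)^\downarrow$ for all $c\in F^\times$.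
   Context: All vector spaces are finite-dimensional over an arbitrary (commutative) field $F$ (any characteristic); $F^\times=F\setminus\{0\}$. $V^*$ is the dual space of $V$ with canonical pairing $\langle a^*,x\rangle$; $o^*$ is the zero vector of $V^*$; $V$ is identified with the dual of $V^*$. The space $F\times V^*$ is identified with the dual space of $F\times V$ via $\langle (a_0,a^* ),(x_0,x)\rangle=a_0x_0+\langle a^*,x\rangle$. The transpose of a linear map $\eta\colon \tilde V\to V$ is $\eta^{\mathrm T}\colon V^*\to\tilde V^*$, $a^*\mapsto a^*\circ\eta$. For a quadratic form $Q\colon V\to F$, its polar form is $B(x,y)=Q(x+y)-Q(x)-Q(y)$; the induced linear mapping is $D\colon V\to V^*$, $D(x)=B(x,\cdot)$; the radical of $B$ is $\{x\in V\mid B(x,y)=0\text{ for all }y\in V\}=\ker D$; $B$ is non-degenerate if its radical is zero, i.e. if $D$ is bijective. The same notions apply to quadratic forms on $F\times V^*$ (whose induced linear mapping takes values in the dual space $F\times V$). Auxiliary linear maps: $\nu\colon V\to F\times V$, $x\mapsto(0,x)$, with transpose $\nu^{\mathrm T}\colon F\times V^*\to V^*$, $(a_0,a^* )\mapsto a^*$; and $\pi\colon F\times V\to V$, $(x_0,x)\mapsto x$, with transpose $\pi^{\mathrm T}\colon V^*\to F\times V^*$, $a^*\mapsto(0,a^* )$.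
   Formalization: In (c) and (d) the scalar laws are corrected to c^{-1}Q^↑=(cQ)^↑ and c^{-1}Q̃^↓=(cQ̃)^↓ for all c≠0; the printed laws with c fail, e.g. for Q(x)=x² over the rationals with c=2. *)

theory Defs
  imports "HOL-Analysis.Product_Vector" "HOL-Library.Function_Algebras"
begin

text \<open>
  The space \<open>V\<close> is a whole type with scalar multiplication \<open>smul\<close>.  Its dual is a subset of
  the function type (with pointwise operations), so the notions that are also needed on
  \<open>F \<times> V\<^sup>*\<close> are relativised to a carrier \<open>W\<close>; for \<open>V\<close> itself take \<open>W = UNIV\<close>.
\<close>

definition linear_map_on ::
  "('f \<Rightarrow> 'u \<Rightarrow> 'u) \<Rightarrow> ('f \<Rightarrow> 'w \<Rightarrow> 'w) \<Rightarrow> 'u::ab_group_add set \<Rightarrow> ('u \<Rightarrow> 'w::ab_group_add) \<Rightarrow> bool"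
  where "linear_map_on s t W g \<longleftrightarrow>
    (\<forall>x\<in>W. \<forall>y\<in>W. g (x + y) = g x + g y) \<and> (\<forall>c. \<forall>x\<in>W. g (s c x) = t c (g x))"

definition polar :: "('w::ab_group_add \<Rightarrow> 'f::field) \<Rightarrow> 'w \<Rightarrow> 'w \<Rightarrow> 'f"
  where "polar Q x y = Q (x + y) - Q x - Q y"

definition quadratic_form ::
  "('f \<Rightarrow> 'w \<Rightarrow> 'w) \<Rightarrow> 'w::ab_group_add set \<Rightarrow> ('w \<Rightarrow> 'f::field) \<Rightarrow> bool"
  where "quadratic_form s W Q \<longleftrightarrow>
    (\<forall>c. \<forall>x\<in>W. Q (s c x) = c\<^sup>2 * Q x) \<and>
    (\<forall>x\<in>W. linear_map_on s (*) W (\<lambda>y. polar Q x y)) \<and>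
    (\<forall>y\<in>W. linear_map_on s (*) W (\<lambda>x. polar Q x y))"

definition radical :: "'w::ab_group_add set \<Rightarrow> ('w \<Rightarrow> 'w \<Rightarrow> 'f::field) \<Rightarrow> 'w set"
  where "radical W B = {x \<in> W. \<forall>y\<in>W. B x y = 0}"

definition nondegenerate :: "'w::ab_group_add set \<Rightarrow> ('w \<Rightarrow> 'w \<Rightarrow> 'f::field) \<Rightarrow> bool"
  where "nondegenerate W B \<longleftrightarrow> radical W B = {0}"

definition dual :: "('f \<Rightarrow> 'v \<Rightarrow> 'v) \<Rightarrow> ('v::ab_group_add \<Rightarrow> 'f::field) set"
  where "dual smul = {a. Vector_Spaces.linear smul (*) a}"

definition dual_scale :: "'f \<Rightarrow> ('v \<Rightarrow> 'f) \<Rightarrow> ('v \<Rightarrow> 'f::field)"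
  where "dual_scale c a = (\<lambda>x. c * a x)"

definition ext_dual :: "('f \<Rightarrow> 'v \<Rightarrow> 'v) \<Rightarrow> ('f \<times> ('v::ab_group_add \<Rightarrow> 'f::field)) set"
  where "ext_dual smul = UNIV \<times> dual smul"

abbreviation ext_dual_scale :: "'f \<Rightarrow> 'f \<times> ('v::ab_group_add \<Rightarrow> 'f) \<Rightarrow> 'f \<times> ('v \<Rightarrow> 'f::field)"
  where "ext_dual_scale \<equiv> module_prod.scale (*) dual_scale"

text \<open>The canonical pairing of \<open>F \<times> V\<^sup>*\<close> with \<open>F \<times> V\<close>.\<close>

definition ext_pairing :: "'f \<times> ('v \<Rightarrow> 'f) \<Rightarrow> 'f \<times> 'v \<Rightarrow> 'f::field"
  where "ext_pairing w p = fst w * fst p + (snd w) (snd p)"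

text \<open>The line \<open>F(1,o\<^sup>*)\<close>.\<close>

definition special_line :: "('f \<times> ('v::ab_group_add \<Rightarrow> 'f::field)) set"
  where "special_line = {ext_dual_scale c (1, 0) |c. True}"

definition induced :: "('v::ab_group_add \<Rightarrow> 'f::field) \<Rightarrow> 'v \<Rightarrow> ('v \<Rightarrow> 'f)"
  where "induced Q x = (\<lambda>y. polar Q x y)"

text \<open>
  The mapping induced by a form on \<open>F \<times> V\<^sup>*\<close> takes its values in the dual of \<open>F \<times> V\<^sup>*\<close>, which
  is identified with \<open>F \<times> V\<close>: the value at \<open>b\<close> is the vector representing the functional
  \<open>polar Q b\<close> via the canonical pairing.
\<close>

definition ext_induced ::
  "('f \<Rightarrow> 'v \<Rightarrow> 'v) \<Rightarrow> ('f \<times> ('v::ab_group_add \<Rightarrow> 'f) \<Rightarrow> 'f::field) \<Rightarrow> 'f \<times> ('v \<Rightarrow> 'f) \<Rightarrow> 'f \<times> 'v"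
  where "ext_induced smul Q b =
    (THE p. \<forall>w \<in> ext_dual smul. ext_pairing w p = polar Q b w)"

text \<open>
  Below, \<open>snd\<close> plays the role of \<open>\<nu>\<^sup>T\<close> (on \<open>F \<times> V\<^sup>*\<close>) and of \<open>\<pi>\<close> (on \<open>F \<times> V\<close>),
  and \<open>Pair 0\<close> that of \<open>\<pi>\<^sup>T\<close>.
\<close>

definition up :: "('v::ab_group_add \<Rightarrow> 'f::field) \<Rightarrow> ('f \<times> ('v \<Rightarrow> 'f) \<Rightarrow> 'f)"
  where "up Q = Q \<circ> inv (induced Q) \<circ> snd"

definition compressed ::
  "('f \<Rightarrow> 'v \<Rightarrow> 'v) \<Rightarrow> ('f \<times> ('v::ab_group_add \<Rightarrow> 'f) \<Rightarrow> 'f::field) \<Rightarrow> ('v \<Rightarrow> 'f) \<Rightarrow> 'v"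
  where "compressed smul Q = snd \<circ> ext_induced smul Q \<circ> Pair 0"

definition down ::
  "('f \<Rightarrow> 'v \<Rightarrow> 'v) \<Rightarrow> ('f \<times> ('v::ab_group_add \<Rightarrow> 'f) \<Rightarrow> 'f::field) \<Rightarrow> ('v \<Rightarrow> 'f)"
  where "down smul Q = Q \<circ> Pair 0 \<circ> inv_into (dual smul) (compressed smul Q)"

text \<open>
  The constructions invert scalars: the polar form of \<open>cQ\<close> induces \<open>cD\<close>, so
  \<open>(cQ) \<circ> (cD)\<^sup>-\<^sup>1 = c \<cdot> c\<^sup>-\<^sup>2 \<cdot> (Q \<circ> D\<^sup>-\<^sup>1)\<close>.  Hence the compatibility with scalars reads
  \<open>c\<^sup>-\<^sup>1 Q\<^sup>\<up> = (cQ)\<^sup>\<up>\<close>, and likewise for \<open>\<down>\<close>; the variant \<open>c Q\<^sup>\<up> = (cQ)\<^sup>\<up>\<close>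
  is not true in general: it fails already for \<open>Q(x) = x\<^sup>2\<close> on the rationals.
\<close>

lemma up_not_homogeneous:
  defines "Q \<equiv> \<lambda>x::rat. x\<^sup>2"
  shows "quadratic_form (*) UNIV Q" "nondegenerate UNIV (polar Q)"
    and "(1, \<lambda>x. x) \<in> ext_dual ((*) :: rat \<Rightarrow> rat \<Rightarrow> rat)"
    and "2 * up Q (1, \<lambda>x. x) \<noteq> up (\<lambda>x. 2 * Q x) (1, \<lambda>x. x)"
proof -
  have pol: "polar (\<lambda>x. c * x\<^sup>2) x y = 2 * c * x * y" for c x y :: rat
    by (simp add: polar_def power2_eq_square algebra_simps)
  have Q: "Q = (\<lambda>x. 1 * x\<^sup>2)" by (simp add: Q_def)
  have polQ: "polar Q x y = 2 * x * y" for x y using pol[of 1] by (simp add: Q)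
  show "quadratic_form (*) UNIV Q"
    unfolding quadratic_form_def linear_map_on_def polQ
    by (auto simp: Q_def power2_eq_square algebra_simps)
  show "nondegenerate UNIV (polar Q)"
    unfolding nondegenerate_def radical_def polQ by (auto dest: spec[of _ 1])
  show "(1, \<lambda>x. x) \<in> ext_dual ((*) :: rat \<Rightarrow> rat \<Rightarrow> rat)"
    by (auto simp: ext_dual_def dual_def Vector_Spaces.linear_def vector_space_def
        module_hom_def module_hom_axioms_def module_def algebra_simps)
  have val: "inv (induced (\<lambda>x. c * x\<^sup>2)) (\<lambda>x. x) = inverse (2 * c)" if "c \<noteq> 0" for c :: rat
  proof (rule inv_f_eq)
    show "inj (induced (\<lambda>x. c * x\<^sup>2))"
      using that by (auto simp: inj_def induced_def pol fun_eq_iff)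
    show "induced (\<lambda>x. c * x\<^sup>2) (inverse (2 * c)) = (\<lambda>x. x)"
      using that by (simp add: induced_def pol fun_eq_iff)
  qed
  have up: "up P (1, \<lambda>x. x) = P (inv (induced P) (\<lambda>x. x))" for P :: "rat \<Rightarrow> rat"
    by (simp add: up_def)
  have i1: "inv (induced Q) (\<lambda>x. x) = 1 / 2" using val[of 1] by (simp add: Q)
  have i2: "inv (induced (\<lambda>x. 2 * Q x)) (\<lambda>x. x) = 1 / 4" using val[of 2] by (simp add: Q)
  show "2 * up Q (1, \<lambda>x. x) \<noteq> up (\<lambda>x. 2 * Q x) (1, \<lambda>x. x)"
    unfolding up i1 i2 by (simp add: Q_def power2_eq_square)
qed

end

theory Submission
  imports Defs
begin

text \<open>
  The two constructions invert the induced mapping of a form.  A form \<open>R\<close> on \<open>F \<times> V\<^sup>*\<close> that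
  vanishes at \<open>(1, o\<^sup>*)\<close> and whose polar form is zero against that vector does not depend on the
  first coordinate: \<open>R (t, a) = R (0, a)\<close>.  So \<open>R\<close> amounts to a form \<open>S\<close> on \<open>V\<^sup>*\<close>, which
  has a non-degenerate polar form because the radical of the polar form of \<open>R\<close> is no larger than
  \<open>F(1, o\<^sup>*)\<close>.  The compressed mapping \<open>C\<close> is then the mapping \<open>V\<^sup>* \<rightarrow> V\<^sup>*\<^sup>* = V\<close> induced
  by \<open>S\<close>: it is determined by \<open>\<langle>b, C a\<rangle> = B\<^sub>S(a, b)\<close>.

  The remainder is the observation that a non-degenerate form \<open>Q\<close> on \<open>V\<close> with induced mapping
  \<open>D\<close> and the form \<open>Q \<circ> D\<^sup>-\<^sup>1\<close> on \<open>V\<^sup>*\<close> have mutually inverse induced mappings, since the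
  polar form of \<open>Q \<circ> D\<^sup>-\<^sup>1\<close> at \<open>(a, b)\<close> is \<open>B(D\<^sup>-\<^sup>1 a, D\<^sup>-\<^sup>1 b) = \<langle>b, D\<^sup>-\<^sup>1 a\<rangle>\<close>; the same
  computation with \<open>S\<close> and \<open>C\<close> shows that \<open>S \<circ> C\<^sup>-\<^sup>1\<close> induces \<open>C\<^sup>-\<^sup>1\<close>
  (\<open>compressed_up\<close>, \<open>induced_down\<close>).  Transporting a form
  twice along inverse mappings gives back the form, and the scalar rules follow from
  \<open>up Q (t, D x) = Q x\<close> and \<open>down R (C a) = R (0, a)\<close> by replacing \<open>D\<close> and \<open>C\<close> with their
  multiples.

  Finite dimension enters through \<open>V\<^sup>*\<^sup>* = V\<close> and through the step from injectivity
  of \<open>D\<close> and \<open>C\<close> to bijectivity; both come from coordinates with respect to a basis.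
\<close>

section \<open>Linear maps and quadratic forms on subsets\<close>

lemma linear_map_onD:
  assumes "linear_map_on s t W g"
  shows "\<lbrakk>x \<in> W; y \<in> W\<rbrakk> \<Longrightarrow> g (x + y) = g x + g y"
    and "x \<in> W \<Longrightarrow> g (s c x) = t c (g x)"
  using assms by (auto simp: linear_map_on_def)

lemma linear_map_on_zero: "linear_map_on s t W g \<Longrightarrow> 0 \<in> W \<Longrightarrow> g 0 = 0"
  using linear_map_onD(1)[of s t W g 0 0] by simp

lemma linear_map_on_inv_into:
  assumes bij: "bij_betw g W W'" and lin: "linear_map_on s t W g"
    and add: "\<And>x y. \<lbrakk>x \<in> W; y \<in> W\<rbrakk> \<Longrightarrow> x + y \<in> W"
    and scale: "\<And>c x. x \<in> W \<Longrightarrow> s c x \<in> W"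
  shows "linear_map_on t s W' (inv_into W g)"
  unfolding linear_map_on_def
proof (intro conjI ballI allI)
  have inj: "inj_on g W" and img: "g ` W = W'" using bij by (auto simp: bij_betw_def)
  fix x assume "x \<in> W'"
  then obtain u where u: "u \<in> W" "x = g u" using img by blast
  show "inv_into W g (t c x) = s c (inv_into W g x)" for c
    using u inj scale by (simp add: linear_map_onD(2)[OF lin, symmetric])
  fix y assume "y \<in> W'"
  then obtain v where v: "v \<in> W" "y = g v" using img by blast
  show "inv_into W g (x + y) = inv_into W g x + inv_into W g y"
    using u v inj add by (simp add: linear_map_onD(1)[OF lin, symmetric])
qed

lemma polar_commute: "polar Q x y = polar Q y x"
  by (simp add: polar_def add.commute)

lemma quadratic_formD:
  assumes "quadratic_form s W Q" "x \<in> W"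
  shows "Q (s c x) = c\<^sup>2 * Q x"
    and "linear_map_on s (*) W (\<lambda>y. polar Q x y)"
    and "linear_map_on s (*) W (\<lambda>y. polar Q y x)"
  using assms by (auto simp: quadratic_form_def)

lemma polar_comp:
  assumes "linear_map_on s t W g" "x \<in> W" "y \<in> W"
  shows "polar (\<lambda>x. Q (g x)) x y = polar Q (g x) (g y)"
  using linear_map_onD(1)[OF assms] by (simp add: polar_def)

lemma quadratic_form_comp:
  assumes lin: "linear_map_on s t W g" and Q: "quadratic_form t W' Q"
    and maps: "\<And>x. x \<in> W \<Longrightarrow> g x \<in> W'"
    and add: "\<And>x y. \<lbrakk>x \<in> W; y \<in> W\<rbrakk> \<Longrightarrow> x + y \<in> W"
    and scale: "\<And>c x. x \<in> W \<Longrightarrow> s c x \<in> W"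
  shows "quadratic_form s W (\<lambda>x. Q (g x))"
  unfolding quadratic_form_def linear_map_on_def
  using add scale maps
  by (simp add: polar_comp[OF lin] linear_map_onD[OF lin] quadratic_formD(1)[OF Q]
      linear_map_onD[OF quadratic_formD(2)[OF Q]] linear_map_onD[OF quadratic_formD(3)[OF Q]])

lemma polar_scale: "polar (\<lambda>x. c * Q x) x y = c * polar Q x y"
  by (simp add: polar_def algebra_simps)

context finite_dimensional_vector_space
begin

section \<open>The dual space in coordinates\<close>

lemma dual_iff: "a \<in> dual scale \<longleftrightarrow> linear_map_on scale (*) UNIV a"
proof -
  have "vector_space ((*) :: 'a \<Rightarrow> 'a \<Rightarrow> 'a)" by unfold_locales (auto simp: algebra_simps)
  then show ?thesis
    using vector_space_axioms by (simp add: dual_def Vector_Spaces.linear_iff linear_map_on_def)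
qed

lemma dualD:
  assumes "a \<in> dual scale"
  shows "a (x + y) = a x + a y" "a (scale c x) = c * a x" "a 0 = 0"
proof -
  note lin = linear_map_onD[OF assms[unfolded dual_iff] UNIV_I]
  show "a (x + y) = a x + a y" for x y using lin(1) by simp
  show "a (scale c x) = c * a x" for c x using lin(2) by simp
  show "a 0 = 0" using linear_map_on_zero[OF assms[unfolded dual_iff]] by simp
qed

lemma dual_sum:
  assumes "a \<in> dual scale"
  shows "a (\<Sum>b\<in>A. scale (c b) (g b)) = (\<Sum>b\<in>A. c b * a (g b))"
  by (induction A rule: infinite_finite_induct) (simp_all add: dualD[OF assms])

lemma dual_closed:
  shows "0 \<in> dual scale"
    and "\<lbrakk>a \<in> dual scale; b \<in> dual scale\<rbrakk> \<Longrightarrow> a + b \<in> dual scale"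
    and "a \<in> dual scale \<Longrightarrow> dual_scale c a \<in> dual scale"
  by (auto simp: dual_iff linear_map_on_def dual_scale_def algebra_simps)

lemma dual_scale_zero: "dual_scale c 0 = (0 :: 'b \<Rightarrow> 'a)"
  by (simp add: dual_scale_def fun_eq_iff)

lemma sum_dual_closed:
  "(\<And>b. b \<in> A \<Longrightarrow> g b \<in> dual scale) \<Longrightarrow> (\<Sum>b\<in>A. dual_scale (c b) (g b)) \<in> dual scale"
  by (induction A rule: infinite_finite_induct) (auto simp: dual_closed)

lemma linear_on_dual_sum:
  assumes f: "linear_map_on dual_scale t (dual scale) f"
    and g: "\<And>b. b \<in> A \<Longrightarrow> g b \<in> dual scale"
  shows "f (\<Sum>b\<in>A. dual_scale (c b) (g b)) = (\<Sum>b\<in>A. t (c b) (f (g b)))"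
  using g
  by (induction A rule: infinite_finite_induct)
     (auto simp: linear_map_on_zero[OF f] linear_map_onD[OF f] sum_dual_closed dual_closed)

definition dual_basis :: "'b \<Rightarrow> 'b \<Rightarrow> 'a"
  where "dual_basis b x = representation Basis x b"

lemma dual_basis_in_dual: "dual_basis b \<in> dual scale"
  by (auto simp: dual_iff linear_map_on_def dual_basis_def representation_add representation_scale
      independent_Basis span_Basis)

lemma dual_basis_Basis: "b \<in> Basis \<Longrightarrow> dual_basis b' b = (if b' = b then 1 else 0)"
  by (simp add: dual_basis_def representation_basis independent_Basis)

lemma sum_dual_basis: "(\<Sum>b\<in>Basis. scale (dual_basis b x) b) = x"
  by (simp add: dual_basis_def sum_representation_eq independent_Basis span_Basis finite_Basis)

lemma dual_basis_sum: "b' \<in> Basis \<Longrightarrow> dual_basis b' (\<Sum>b\<in>Basis. scale (c b) b) = c b'"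
  by (simp add: dual_sum[OF dual_basis_in_dual] dual_basis_Basis finite_Basis if_distrib[of "(*) _"]
      cong: if_cong)

lemma dual_expansion:
  assumes "a \<in> dual scale"
  shows "a = (\<Sum>b\<in>Basis. dual_scale (a b) (dual_basis b))"
proof
  fix x
  have "a x = (\<Sum>b\<in>Basis. dual_basis b x * a b)"
    using dual_sum[OF assms, of "\<lambda>b. dual_basis b x" "\<lambda>b. b" Basis] by (simp add: sum_dual_basis)
  moreover have "(\<Sum>b\<in>A. dual_scale (a b) (dual_basis b)) x = (\<Sum>b\<in>A. dual_basis b x * a b)" for A
    by (induction A rule: infinite_finite_induct) (simp_all add: dual_scale_def mult.commute)
  ultimately show "a x = (\<Sum>b\<in>Basis. dual_scale (a b) (dual_basis b)) x" by simp
qed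

lemma dual_separates:
  assumes "\<And>a. a \<in> dual scale \<Longrightarrow> a x = a y"
  shows "x = y"
proof -
  have "dual_basis b x = dual_basis b y" for b by (rule assms[OF dual_basis_in_dual])
  then have "(\<Sum>b\<in>Basis. scale (dual_basis b x) b) = (\<Sum>b\<in>Basis. scale (dual_basis b y) b)" by simp
  then show ?thesis by (simp only: sum_dual_basis)
qed

text \<open>
  A linear functional on \<open>V\<^sup>*\<close> is evaluation at the vector whose coordinates are its values on
  the dual basis; this is the identification of \<open>V\<close> with \<open>V\<^sup>*\<^sup>*\<close>.
\<close>

lemma dual_functional_is_evaluation:
  assumes f: "linear_map_on dual_scale (*) (dual scale) f"
  shows "\<exists>x. \<forall>a\<in>dual scale. a x = f a"
proof (intro exI ballI)
  fix a assume a: "a \<in> dual scale"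
  have "f a = f (\<Sum>b\<in>Basis. dual_scale (a b) (dual_basis b))"
    by (rule arg_cong[OF dual_expansion[OF a]])
  also have "\<dots> = (\<Sum>b\<in>Basis. a b * f (dual_basis b))"
    by (rule linear_on_dual_sum[OF f dual_basis_in_dual])
  also have "\<dots> = a (\<Sum>b\<in>Basis. scale (f (dual_basis b)) b)"
    by (simp add: dual_sum[OF a] mult.commute)
  finally show "a (\<Sum>b\<in>Basis. scale (f (dual_basis b)) b) = f a" by simp
qed

text \<open>
  An isomorphism of \<open>V\<^sup>*\<close> with \<open>V\<close> reduces dimension counts for maps between the two spaces
  to the fact that an injective endomorphism of \<open>V\<close> is surjective.
\<close>

definition dual_iso :: "('b \<Rightarrow> 'a) \<Rightarrow> 'b"
  where "dual_iso a = (\<Sum>b\<in>Basis. scale (a b) b)"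

lemma linear_dual_iso: "linear_map_on dual_scale scale UNIV dual_iso"
  by (simp add: linear_map_on_def dual_iso_def dual_scale_def scale_left_distrib
      sum.distrib scale_sum_right)

lemma bij_dual_iso: "bij_betw dual_iso (dual scale) UNIV"
  unfolding bij_betw_def
proof
  show "inj_on dual_iso (dual scale)"
  proof (rule inj_onI)
    fix a a' assume a: "a \<in> dual scale" "a' \<in> dual scale" and eq: "dual_iso a = dual_iso a'"
    have "a b = a' b" if "b \<in> Basis" for b
      using eq dual_basis_sum[OF that, of a] dual_basis_sum[OF that, of a'] by (simp add: dual_iso_def)
    then have "(\<Sum>b\<in>Basis. dual_scale (a b) (dual_basis b)) =
        (\<Sum>b\<in>Basis. dual_scale (a' b) (dual_basis b))"
      by simp
    then show "a = a'"
      by (simp only: dual_expansion[OF a(1), symmetric] dual_expansion[OF a(2), symmetric])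
  qed
  have "x \<in> dual_iso ` dual scale" for x
  proof -
    define a where "a = (\<Sum>b\<in>Basis. dual_scale (dual_basis b x) (dual_basis b))"
    have "dual_iso a = (\<Sum>b\<in>Basis. scale (dual_basis b x) (dual_iso (dual_basis b)))"
      unfolding a_def
      by (rule linear_on_dual_sum)
         (use linear_dual_iso in \<open>auto simp: linear_map_on_def dual_basis_in_dual\<close>)
    also have "\<dots> = (\<Sum>b\<in>Basis. scale (dual_basis b x) b)"
      by (rule sum.cong)
         (auto simp: dual_iso_def dual_basis_Basis finite_Basis if_distrib[of "\<lambda>c. scale c _"]
           cong: if_cong)
    finally have "dual_iso a = x" by (simp add: sum_dual_basis)
    moreover have "a \<in> dual scale" by (simp add: a_def sum_dual_closed dual_basis_in_dual)
    ultimately show "x \<in> dual_iso ` dual scale" by blast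
  qed
  then show "dual_iso ` dual scale = UNIV" by blast
qed

lemma surj_endomorphism:
  assumes "linear_map_on scale scale UNIV h" "inj h"
  shows "surj h"
  using assms vector_space_axioms
  by (intro linear_inj_imp_surj) (auto simp: Vector_Spaces.linear_iff linear_map_on_def)

lemma bij_into_dual:
  assumes lin: "linear_map_on scale dual_scale UNIV D" and inj: "inj D"
    and maps: "\<And>x. D x \<in> dual scale"
  shows "bij_betw D UNIV (dual scale)"
proof -
  have iso: "inj_on dual_iso (dual scale)" using bij_dual_iso by (simp add: bij_betw_def)
  have "surj (\<lambda>x. dual_iso (D x))"
  proof (rule surj_endomorphism)
    show "linear_map_on scale scale UNIV (\<lambda>x. dual_iso (D x))"
      using lin linear_dual_iso by (simp add: linear_map_on_def)
    show "inj (\<lambda>x. dual_iso (D x))"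
      by (intro injI, rule injD[OF inj], rule inj_onD[OF iso]) (simp_all add: maps)
  qed
  have "a \<in> range D" if a: "a \<in> dual scale" for a
  proof -
    obtain x where "dual_iso a = dual_iso (D x)"
      using surjD[OF \<open>surj (\<lambda>x. dual_iso (D x))\<close>] by blast
    then have "a = D x" using inj_onD[OF iso] a maps by blast
    then show ?thesis by blast
  qed
  then show ?thesis using inj maps by (auto simp: bij_betw_def)
qed

lemma bij_from_dual:
  assumes lin: "linear_map_on dual_scale scale (dual scale) C" and inj: "inj_on C (dual scale)"
  shows "bij_betw C (dual scale) UNIV"
proof -
  let ?i = "inv_into (dual scale) dual_iso"
  have maps: "?i x \<in> dual scale" for x
    using bij_dual_iso by (metis bij_betw_def inv_into_into UNIV_I)
  have "inj ?i" using bij_dual_iso by (simp add: bij_betw_def inj_on_inv_into)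
  have i: "linear_map_on scale dual_scale UNIV ?i"
    by (rule linear_map_on_inv_into[OF bij_dual_iso _ dual_closed(2,3)])
       (use linear_dual_iso in \<open>simp_all add: linear_map_on_def\<close>)
  have "surj (\<lambda>x. C (?i x))"
  proof (rule surj_endomorphism)
    show "linear_map_on scale scale UNIV (\<lambda>x. C (?i x))"
      using linear_map_onD[OF i] linear_map_onD[OF lin] maps by (simp add: linear_map_on_def)
    show "inj (\<lambda>x. C (?i x))"
      by (intro injI, rule injD[OF \<open>inj ?i\<close>], rule inj_onD[OF inj]) (simp_all add: maps)
  qed
  then have "C ` dual scale = UNIV" using maps by (auto simp: surj_def)
  then show ?thesis using inj by (simp add: bij_betw_def)
qed

section \<open>The space \<open>F \<times> V\<^sup>*\<close>\<close>

lemma ext_dual_scale_Pair: "ext_dual_scale c (t, a :: 'b \<Rightarrow> 'a) = (c * t, dual_scale c a)"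
proof (rule module_prod.scale_prod)
  show "module_prod ((*) :: 'a \<Rightarrow> 'a \<Rightarrow> 'a) (dual_scale :: 'a \<Rightarrow> ('b \<Rightarrow> 'a) \<Rightarrow> 'b \<Rightarrow> 'a)"
    by unfold_locales (auto simp: algebra_simps dual_scale_def)
qed

lemma ext_dual_iff: "(t, a) \<in> ext_dual scale \<longleftrightarrow> a \<in> dual scale"
  by (simp add: ext_dual_def)

lemma ext_dual_closed:
  shows "\<lbrakk>v \<in> ext_dual scale; w \<in> ext_dual scale\<rbrakk> \<Longrightarrow> v + w \<in> ext_dual scale"
    and "w \<in> ext_dual scale \<Longrightarrow> ext_dual_scale c w \<in> ext_dual scale"
  by (cases v; cases w; auto simp: ext_dual_iff dual_closed ext_dual_scale_Pair)+

lemma special_line_eq: "special_line = UNIV \<times> {0 :: 'b \<Rightarrow> 'a}"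
  by (auto simp: special_line_def ext_dual_scale_Pair dual_scale_zero)

section \<open>Lifting a non-degenerate form on \<open>V\<close>\<close>

text \<open>The classes of forms that the two constructions exchange.\<close>

definition regular_form :: "('b \<Rightarrow> 'a) \<Rightarrow> bool"
  where "regular_form Q \<longleftrightarrow> quadratic_form scale UNIV Q \<and> nondegenerate UNIV (polar Q)"

definition line_form :: "('a \<times> ('b \<Rightarrow> 'a) \<Rightarrow> 'a) \<Rightarrow> bool"
  where "line_form R \<longleftrightarrow> quadratic_form ext_dual_scale (ext_dual scale) R \<and> R (1, 0) = 0 \<and>
    radical (ext_dual scale) (polar R) = special_line"

lemma linear_induced:
  assumes "quadratic_form scale UNIV Q"
  shows "linear_map_on scale dual_scale UNIV (induced Q)" "induced Q x \<in> dual scale"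
  using assms
  by (auto simp: quadratic_form_def linear_map_on_def induced_def dual_scale_def dual_iff)

lemma bij_induced:
  assumes Q: "regular_form Q"
  shows "bij_betw (induced Q) UNIV (dual scale)"
proof (rule bij_into_dual)
  have quad: "quadratic_form scale UNIV Q" and nd: "nondegenerate UNIV (polar Q)"
    using Q by (auto simp: regular_form_def)
  note D = linear_induced[OF quad]
  show "linear_map_on scale dual_scale UNIV (induced Q)" "induced Q x \<in> dual scale" for x
    by (rule D)+
  show "inj (induced Q)"
  proof (rule injI)
    fix x y assume eq: "induced Q x = induced Q y"
    have "induced Q x = induced Q (x - y) + induced Q y"
      using linear_map_onD(1)[OF D(1), of "x - y" y] by simp
    then have "induced Q (x - y) = 0" using eq by simp
    then have "x - y \<in> radical UNIV (polar Q)"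
      by (simp add: radical_def induced_def fun_eq_iff)
    then show "x = y" using nd by (simp add: nondegenerate_def)
  qed
qed

lemma linear_inv_induced:
  assumes "regular_form Q"
  shows "linear_map_on dual_scale scale (dual scale) (inv (induced Q))"
  by (rule linear_map_on_inv_into[OF bij_induced[OF assms] linear_induced(1)])
     (use assms in \<open>auto simp: regular_form_def\<close>)

lemma induced_inv:
  "regular_form Q \<Longrightarrow> a \<in> dual scale \<Longrightarrow> induced Q (inv (induced Q) a) = a"
  using bij_induced[of Q] by (metis bij_betw_inv_into_right)

lemma inv_induced: "regular_form Q \<Longrightarrow> inv (induced Q) (induced Q x) = x"
  using bij_induced[of Q] by (metis bij_betw_inv_into_left UNIV_I)

lemma up_Pair: "up Q (t, a) = Q (inv (induced Q) a)"
  by (simp add: up_def)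

lemma up_induced: "regular_form Q \<Longrightarrow> up Q (t, induced Q x) = Q x"
  by (simp add: up_Pair inv_induced)

lemma linear_inv_induced_snd:
  assumes "regular_form Q"
  shows "linear_map_on ext_dual_scale scale (ext_dual scale) (\<lambda>w. inv (induced Q) (snd w))"
  using linear_map_onD[OF linear_inv_induced[OF assms]]
  by (auto simp: linear_map_on_def ext_dual_def ext_dual_scale_Pair)

lemma polar_up:
  assumes Q: "regular_form Q" and "a \<in> dual scale" "b \<in> dual scale"
  shows "polar (up Q) (t, a) (s, b) = a (inv (induced Q) b)"
proof -
  have "up Q = (\<lambda>w. Q (inv (induced Q) (snd w)))" by (simp add: up_def fun_eq_iff)
  then have "polar (up Q) (t, a) (s, b) = induced Q (inv (induced Q) a) (inv (induced Q) b)"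
    using polar_comp[OF linear_inv_induced_snd[OF Q], of "(t, a)" "(s, b)"] assms
    by (simp add: ext_dual_iff induced_def)
  then show ?thesis using assms by (simp add: induced_inv)
qed

lemma line_form_up:
  assumes Q: "regular_form Q"
  shows "line_form (up Q)"
  unfolding line_form_def
proof (intro conjI)
  have quad: "quadratic_form scale UNIV Q" using Q by (simp add: regular_form_def)
  have up: "up Q = (\<lambda>w. Q (inv (induced Q) (snd w)))" by (simp add: up_def fun_eq_iff)
  show "quadratic_form ext_dual_scale (ext_dual scale) (up Q)"
    unfolding up
    by (rule quadratic_form_comp[OF linear_inv_induced_snd[OF Q] quad UNIV_I ext_dual_closed])
  have "induced Q 0 = 0"
    by (rule linear_map_on_zero[OF linear_induced(1)[OF quad] UNIV_I])
  then have "up Q (1, 0) = Q 0" using up_induced[OF Q, of 1 0] by simp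
  then show "up Q (1, 0) = 0" using quadratic_formD(1)[OF quad, of 0 0] by simp
  \<comment> \<open>As the inverse of the induced mapping is onto \<open>V\<close>, only \<open>a = 0\<close> pairs trivially with its range.\<close>
  have "a = 0" if a: "a \<in> dual scale" and 0: "\<forall>b\<in>dual scale. a (inv (induced Q) b) = 0" for a
  proof
    fix x
    show "a x = 0 x" using 0 linear_induced(2)[OF quad, of x] inv_induced[OF Q, of x] by auto
  qed
  then show "radical (ext_dual scale) (polar (up Q)) = special_line"
    by (auto simp: radical_def special_line_eq ext_dual_def polar_up[OF Q] dual_closed)
qed

section \<open>Descending from \<open>F \<times> V\<^sup>*\<close>\<close>

text \<open>
  Both \<open>R (1, 0) = 0\<close> and the radical condition enter: the former kills \<open>R (t, 0)\<close>, the
  latter the mixed term \<open>polar R (t, 0) (0, a)\<close> in the expansion of \<open>R (t, a)\<close>.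
\<close>

lemma line_form_first_coordinate:
  assumes R: "line_form R" and a: "a \<in> dual scale"
  shows "R (t, a) = R (0, a)"
    and "b \<in> dual scale \<Longrightarrow> polar R (t, a) (s, b) = polar R (0, a) (0, b)"
proof -
  have quad: "quadratic_form ext_dual_scale (ext_dual scale) R" and R1: "R (1, 0) = 0"
    and rad: "radical (ext_dual scale) (polar R) = special_line"
    using R by (auto simp: line_form_def)
  have drop: "R (t, a) = R (0, a)" if a: "a \<in> dual scale" for t a
  proof -
    have "(t, 0) \<in> radical (ext_dual scale) (polar R)" by (simp add: rad special_line_eq)
    then have "polar R (t, 0) (0, a) = 0"
      using a unfolding radical_def by (auto simp: ext_dual_iff)
    moreover have "R (t, 0) = 0"
      using quadratic_formD(1)[OF quad, of "(1, 0)" t] R1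
      by (simp add: ext_dual_iff dual_closed ext_dual_scale_Pair dual_scale_zero)
    ultimately show ?thesis by (simp add: polar_def)
  qed
  show "R (t, a) = R (0, a)" by (rule drop[OF a])
  show "polar R (t, a) (s, b) = polar R (0, a) (0, b)" if b: "b \<in> dual scale"
    using drop[OF a, of t] drop[OF b, of s] drop[OF dual_closed(2)[OF a b], of "t + s"]
    by (simp add: polar_def)
qed

lemma linear_polar_line_form:
  assumes R: "line_form R" and a: "a \<in> dual scale"
  shows "linear_map_on dual_scale (*) (dual scale) (\<lambda>b. polar R (0, a) (0, b))"
proof -
  have "quadratic_form ext_dual_scale (ext_dual scale) R" using R by (simp add: line_form_def)
  from quadratic_formD(2)[OF this, of "(0, a)"] a
  have lin: "linear_map_on ext_dual_scale (*) (ext_dual scale) (polar R (0, a))"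
    by (simp add: ext_dual_iff)
  show ?thesis
    using linear_map_onD(1)[OF lin, of "(0, _)" "(0, _)"] linear_map_onD(2)[OF lin, of "(0, _)"]
    by (simp add: linear_map_on_def ext_dual_iff ext_dual_scale_Pair)
qed

text \<open>
  The vector of \<open>F \<times> V\<close> representing \<open>polar R (0, a)\<close> has first coordinate \<open>0\<close>, because this
  functional vanishes at \<open>(1, o\<^sup>*)\<close>; its second coordinate comes from \<open>V\<^sup>*\<^sup>* = V\<close>.
\<close>

lemma compressed_eqI:
  assumes R: "line_form R" and a: "a \<in> dual scale"
    and x: "\<And>b. b \<in> dual scale \<Longrightarrow> b x = polar R (0, a) (0, b)"
  shows "compressed scale R a = x"
proof -
  have "ext_induced scale R (0, a) = (0, x)"
    unfolding ext_induced_def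
  proof (rule the_equality)
    show "\<forall>w\<in>ext_dual scale. ext_pairing w (0, x) = polar R (0, a) w"
      using line_form_first_coordinate(2)[OF R a] x by (auto simp: ext_dual_def ext_pairing_def)
    fix p assume p: "\<forall>w\<in>ext_dual scale. ext_pairing w p = polar R (0, a) w"
    have p': "s * fst p + b (snd p) = b x" if b: "b \<in> dual scale" for s b
    proof -
      have "(s, b) \<in> ext_dual scale" using b by (simp add: ext_dual_iff)
      with p have "ext_pairing (s, b) p = polar R (0, a) (s, b)" by blast
      then show ?thesis
        using line_form_first_coordinate(2)[OF R a b, of 0 s] x[OF b]
        by (simp add: ext_pairing_def)
    qed
    have "fst p = 0" using p'[OF dual_closed(1), of 1] by simp
    moreover have "snd p = x" by (rule dual_separates) (use p'[of _ 0] in simp)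
    ultimately show "p = (0, x)" by (simp add: prod_eq_iff)
  qed
  then show ?thesis by (simp add: compressed_def)
qed

lemma dual_compressed:
  assumes R: "line_form R" and a: "a \<in> dual scale" and b: "b \<in> dual scale"
  shows "b (compressed scale R a) = polar R (0, a) (0, b)"
proof -
  obtain x where x: "\<forall>b\<in>dual scale. b x = polar R (0, a) (0, b)"
    using dual_functional_is_evaluation[OF linear_polar_line_form[OF R a]] by blast
  then have "compressed scale R a = x" by (intro compressed_eqI[OF R a]) blast
  then show ?thesis using x b by blast
qed

lemma linear_compressed:
  assumes R: "line_form R"
  shows "linear_map_on dual_scale scale (dual scale) (compressed scale R)"
  unfolding linear_map_on_def
proof (intro conjI ballI allI)
  fix a assume a: "a \<in> dual scale"
  show "compressed scale R (dual_scale c a) = scale c (compressed scale R a)" for c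
  proof (rule compressed_eqI[OF R dual_closed(3)[OF a]])
    fix b assume b: "b \<in> dual scale"
    show "b (scale c (compressed scale R a)) = polar R (0, dual_scale c a) (0, b)"
      using linear_map_onD(2)[OF linear_polar_line_form[OF R b] a, of c]
      by (simp add: dualD[OF b] dual_compressed[OF R a b] polar_commute[of R "(0, b)"])
  qed
  fix a' assume a': "a' \<in> dual scale"
  show "compressed scale R (a + a') = compressed scale R a + compressed scale R a'"
  proof (rule compressed_eqI[OF R dual_closed(2)[OF a a']])
    fix b assume b: "b \<in> dual scale"
    show "b (compressed scale R a + compressed scale R a') = polar R (0, a + a') (0, b)"
      using linear_map_onD(1)[OF linear_polar_line_form[OF R b] a a']
      by (simp add: dualD[OF b] dual_compressed[OF R a b] dual_compressed[OF R a' b]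
          polar_commute[of R "(0, b)"])
  qed
qed

lemma bij_compressed:
  assumes R: "line_form R"
  shows "bij_betw (compressed scale R) (dual scale) UNIV"
proof (rule bij_from_dual[OF linear_compressed[OF R]], rule inj_onI)
  fix a a' assume a: "a \<in> dual scale" and a': "a' \<in> dual scale"
    and eq: "compressed scale R a = compressed scale R a'"
  let ?d = "a + dual_scale (-1) a'"
  have d: "?d \<in> dual scale" by (intro dual_closed a a')
  have "polar R (0, ?d) (s, b) = 0" if b: "b \<in> dual scale" for s b
  proof -
    note lin = linear_map_onD[OF linear_polar_line_form[OF R b]]
    have "polar R (0, ?d) (s, b) = polar R (0, ?d) (0, b)"
      by (rule line_form_first_coordinate(2)[OF R d b])
    also have "\<dots> = polar R (0, b) (0, ?d)" by (rule polar_commute)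
    also have "\<dots> = polar R (0, b) (0, a) - polar R (0, b) (0, a')"
      using a a' by (simp add: lin dual_closed)
    also have "\<dots> = 0"
      using dual_compressed[OF R a b] dual_compressed[OF R a' b] eq
      by (simp add: polar_commute[of R "(0, b)"])
    finally show ?thesis .
  qed
  then have "(0, ?d) \<in> radical (ext_dual scale) (polar R)"
    using d by (simp add: radical_def ext_dual_def)
  then have "?d = 0" using R by (simp add: line_form_def special_line_eq)
  then show "a = a'" by (simp add: fun_eq_iff dual_scale_def)
qed

lemma inv_compressed:
  assumes "line_form R"
  shows "inv_into (dual scale) (compressed scale R) x \<in> dual scale"
    and "compressed scale R (inv_into (dual scale) (compressed scale R) x) = x"
    and "a \<in> dual scale \<Longrightarrow> inv_into (dual scale) (compressed scale R) (compressed scale R a) = a"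
  using bij_compressed[OF assms]
  by (metis bij_betw_def inv_into_into UNIV_I, metis bij_betw_inv_into_right UNIV_I,
      metis bij_betw_inv_into_left)

lemma linear_inv_compressed:
  assumes "line_form R"
  shows "linear_map_on scale dual_scale UNIV (inv_into (dual scale) (compressed scale R))"
  by (rule linear_map_on_inv_into[OF bij_compressed linear_compressed dual_closed(2,3)])
     (use assms in auto)

lemma down_compressed:
  "line_form R \<Longrightarrow> a \<in> dual scale \<Longrightarrow> down scale R (compressed scale R a) = R (0, a)"
  by (simp add: down_def inv_compressed)

lemma linear_Pair_inv_compressed:
  assumes "line_form R"
  shows "linear_map_on scale ext_dual_scale UNIV
    (\<lambda>x. (0, inv_into (dual scale) (compressed scale R) x))"
  using linear_map_onD[OF linear_inv_compressed[OF assms]]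
  by (simp add: linear_map_on_def ext_dual_scale_Pair)

text \<open>
  With \<open>C\<close> the compressed mapping, the polar form of \<open>down R\<close> at \<open>(x, y)\<close> is that of \<open>R\<close> at
  \<open>(C\<^sup>-\<^sup>1 x, C\<^sup>-\<^sup>1 y)\<close>, hence equals \<open>\<langle>C\<^sup>-\<^sup>1 x, C (C\<^sup>-\<^sup>1 y)\<rangle> = \<langle>C\<^sup>-\<^sup>1 x, y\<rangle>\<close>.
\<close>

lemma induced_down:
  assumes R: "line_form R"
  shows "induced (down scale R) = inv_into (dual scale) (compressed scale R)"
proof (intro ext)
  fix x y
  let ?E = "inv_into (dual scale) (compressed scale R)"
  have "down scale R = (\<lambda>x. R (0, ?E x))" by (simp add: down_def fun_eq_iff)
  then have "induced (down scale R) x y = polar R (0, ?E x) (0, ?E y)"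
    using polar_comp[OF linear_Pair_inv_compressed[OF R], of x y R] by (simp add: induced_def)
  also have "\<dots> = polar R (0, ?E y) (0, ?E x)" by (rule polar_commute)
  also have "\<dots> = ?E x (compressed scale R (?E y))"
    by (rule dual_compressed[symmetric]) (simp_all add: R inv_compressed)
  finally show "induced (down scale R) x y = ?E x y" by (simp add: R inv_compressed)
qed

lemma regular_form_down:
  assumes R: "line_form R"
  shows "regular_form (down scale R)"
  unfolding regular_form_def
proof
  let ?E = "inv_into (dual scale) (compressed scale R)"
  have quad: "quadratic_form ext_dual_scale (ext_dual scale) R"
    using R by (simp add: line_form_def)
  have "down scale R = (\<lambda>x. R (0, ?E x))" by (simp add: down_def fun_eq_iff)
  then show q: "quadratic_form scale UNIV (down scale R)"
    using quadratic_form_comp[OF linear_Pair_inv_compressed[OF R] quad]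
    by (simp add: ext_dual_iff inv_compressed[OF R])
  have "x = 0" if "\<forall>y. polar (down scale R) x y = 0" for x
  proof -
    have "?E x = 0"
      using that by (simp add: induced_down[OF R, symmetric] induced_def fun_eq_iff)
    moreover have "?E 0 = 0" by (rule linear_map_on_zero[OF linear_inv_compressed[OF R] UNIV_I])
    ultimately show "x = 0" using inv_compressed(2)[OF R] by metis
  qed
  moreover have "polar (down scale R) 0 y = 0" for y
    by (rule linear_map_on_zero[OF quadratic_formD(3)[OF q UNIV_I] UNIV_I])
  ultimately show "nondegenerate UNIV (polar (down scale R))"
    by (auto simp: nondegenerate_def radical_def)
qed

section \<open>The constructions are mutually inverse\<close>

lemma compressed_up:
  assumes Q: "regular_form Q" and a: "a \<in> dual scale"
  shows "compressed scale (up Q) a = inv (induced Q) a"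
proof (rule compressed_eqI[OF line_form_up[OF Q] a])
  fix b assume b: "b \<in> dual scale"
  show "b (inv (induced Q) a) = polar (up Q) (0, a) (0, b)"
    using polar_up[OF Q b a] by (simp add: polar_commute[of _ "(0, a)"])
qed

lemma down_up:
  assumes Q: "regular_form Q"
  shows "down scale (up Q) = Q"
proof
  fix x
  have D: "induced Q x \<in> dual scale" using linear_induced(2) Q by (simp add: regular_form_def)
  show "down scale (up Q) x = Q x"
    using down_compressed[OF line_form_up[OF Q] D] up_induced[OF Q]
    by (simp add: compressed_up[OF Q D] inv_induced[OF Q])
qed

lemma up_down:
  assumes R: "line_form R" and w: "w \<in> ext_dual scale"
  shows "up (down scale R) w = R w"
proof -
  obtain t a where w': "w = (t, a)" and a: "a \<in> dual scale"
    using w by (cases w) (auto simp: ext_dual_iff)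
  have "induced (down scale R) (compressed scale R a) = a"
    using a by (simp add: induced_down[OF R] inv_compressed(3)[OF R])
  then have "up (down scale R) (t, a) = R (0, a)"
    using up_induced[OF regular_form_down[OF R], of t "compressed scale R a"]
    by (simp add: down_compressed[OF R a])
  then show ?thesis by (simp add: w' line_form_first_coordinate(1)[OF R a, of t])
qed

section \<open>Scalar multiples\<close>

lemma regular_form_scale:
  assumes "regular_form Q" "c \<noteq> 0"
  shows "regular_form (\<lambda>x. c * Q x)"
  using assms
  by (simp add: regular_form_def quadratic_form_def nondegenerate_def radical_def polar_scale
      linear_map_on_def algebra_simps)

lemma line_form_scale:
  assumes "line_form R" "c \<noteq> 0"
  shows "line_form (\<lambda>w. c * R w)"
  using assms
  by (simp add: line_form_def quadratic_form_def radical_def polar_scale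
      linear_map_on_def algebra_simps)

text \<open>
  The mapping induced by \<open>cQ\<close> is \<open>cD\<close>.  Hence the functional \<open>cD x\<close> is sent to \<open>c Q x\<close> by
  \<open>up (cQ)\<close>, but to \<open>Q (c x) = c\<^sup>2 Q x\<close> by \<open>up Q\<close>.
\<close>

lemma up_scale:
  assumes Q: "regular_form Q" and c: "c \<noteq> 0" and w: "w \<in> ext_dual scale"
  shows "inverse c * up Q w = up (\<lambda>x. c * Q x) w"
proof -
  note cQ = regular_form_scale[OF Q c]
  have quad: "quadratic_form scale UNIV Q" using Q by (simp add: regular_form_def)
  \<comment> \<open>Parametrise by \<open>V\<close> through the bijection that \<open>cQ\<close> induces, so that both sides are explicit.\<close>
  obtain t x where w': "w = (t, induced (\<lambda>x. c * Q x) x)"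
    using w induced_inv[OF cQ] by (cases w) (metis ext_dual_iff)
  have "induced (\<lambda>x. c * Q x) x = induced Q (scale c x)"
    using linear_map_onD(2)[OF linear_induced(1)[OF quad]]
    by (simp add: induced_def polar_scale dual_scale_def)
  then have "up Q w = c\<^sup>2 * Q x"
    by (simp add: w' up_induced[OF Q] quadratic_formD(1)[OF quad])
  moreover have "up (\<lambda>x. c * Q x) w = c * Q x" by (simp add: w' up_induced[OF cQ])
  ultimately show ?thesis using c by (simp add: power2_eq_square)
qed

lemma compressed_scale:
  assumes R: "line_form R" and c: "c \<noteq> 0" and a: "a \<in> dual scale"
  shows "compressed scale (\<lambda>w. c * R w) a = compressed scale R (dual_scale c a)"
proof (rule compressed_eqI[OF line_form_scale[OF R c] a])
  fix b assume b: "b \<in> dual scale"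
  show "b (compressed scale R (dual_scale c a)) = polar (\<lambda>w. c * R w) (0, a) (0, b)"
    by (simp add: linear_map_onD(2)[OF linear_compressed[OF R] a] dualD[OF b]
        dual_compressed[OF R a b] polar_scale)
qed

text \<open>
  Dually, the vector \<open>C (c a)\<close> is sent to \<open>c R (0, a)\<close> by \<open>down (cR)\<close>, but to
  \<open>R (0, c a) = c\<^sup>2 R (0, a)\<close> by \<open>down R\<close>.
\<close>

lemma down_scale:
  assumes R: "line_form R" and c: "c \<noteq> 0"
  shows "inverse c * down scale R x = down scale (\<lambda>w. c * R w) x"
proof -
  note cR = line_form_scale[OF R c]
  have quad: "quadratic_form ext_dual_scale (ext_dual scale) R"
    using R by (simp add: line_form_def)
  obtain a where a: "a \<in> dual scale" and x: "x = compressed scale (\<lambda>w. c * R w) a"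
    using inv_compressed(1,2)[OF cR] by metis
  have "down scale R x = R (0, dual_scale c a)"
    by (simp add: x compressed_scale[OF R c a] down_compressed[OF R] dual_closed a)
  also have "\<dots> = c\<^sup>2 * R (0, a)"
    using quadratic_formD(1)[OF quad, of "(0, a)" c] a
    by (simp add: ext_dual_iff ext_dual_scale_Pair)
  finally have "down scale R x = c\<^sup>2 * R (0, a)" .
  moreover have "down scale (\<lambda>w. c * R w) x = c * R (0, a)"
    by (simp add: x down_compressed[OF cR a])
  ultimately show ?thesis using c by (simp add: power2_eq_square)
qed

end

theorem proposition5p1:
  fixes smul :: "'f::field \<Rightarrow> 'v::ab_group_add \<Rightarrow> 'v"
    and Basis :: "'v set"
  assumes "finite_dimensional_vector_space smul Basis"
  shows
    "(\<forall>Q. quadratic_form smul UNIV Q \<and> nondegenerate UNIV (polar Q) \<longrightarrow>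
        quadratic_form ext_dual_scale (ext_dual smul) (up Q) \<and>
        up Q (1, 0) = 0 \<and>
        radical (ext_dual smul) (polar (up Q)) = special_line)
   \<and> (\<forall>R. quadratic_form ext_dual_scale (ext_dual smul) R \<and> R (1, 0) = 0 \<and>
          radical (ext_dual smul) (polar R) = special_line \<longrightarrow>
        linear_map_on dual_scale smul (dual smul) (compressed smul R) \<and>
        bij_betw (compressed smul R) (dual smul) UNIV \<and>
        quadratic_form smul UNIV (down smul R) \<and>
        nondegenerate UNIV (polar (down smul R)))
   \<and> (\<forall>Q. quadratic_form smul UNIV Q \<and> nondegenerate UNIV (polar Q) \<longrightarrow>
        down smul (up Q) = Q \<and>
        (\<forall>c. c \<noteq> 0 \<longrightarrow>
          (\<forall>w \<in> ext_dual smul. inverse c * up Q w = up (\<lambda>x. c * Q x) w)))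
   \<and> (\<forall>R. quadratic_form ext_dual_scale (ext_dual smul) R \<and> R (1, 0) = 0 \<and>
          radical (ext_dual smul) (polar R) = special_line \<longrightarrow>
        (\<forall>w \<in> ext_dual smul. up (down smul R) w = R w) \<and>
        (\<forall>c. c \<noteq> 0 \<longrightarrow>
          (\<lambda>x. inverse c * down smul R x) = down smul (\<lambda>w. c * R w)))"
proof -
  interpret finite_dimensional_vector_space smul Basis by fact
  note forms = regular_form_def[symmetric] line_form_def[symmetric]
  show ?thesis
    unfolding forms
    using line_form_up[unfolded line_form_def] regular_form_down[unfolded regular_form_def]
      linear_compressed bij_compressed down_up up_scale up_down down_scale
    by (simp add: fun_eq_iff regular_form_down line_form_up)
qed

end
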